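(* Let $G$ be a separable metrisable topological group. Then $G$ admits a maximal compatible left-invariant metric $d$ if and only if $G$ is generated by an open set with property (OB) relative to $G$.
   Context: A metrisable topological group is a topological group whose topology can be induced by some metric. A metric on $G$ is compatible if it induces the topology of $G$, and left-invariant if $d(hg,hf)=d(g,f)$ for all $g,f,h\in G$. A subset $A\subseteq G$ has property (OB) relative to $G$ if $A$ has finite diameter with respect to every compatible left-invariant metric on $G$. A compatible left-invariant metric $d$ on $G$ is maximal if for every compatible left-invariant metric $\partial$ on $G$ there is a constant $K$ with $\partial\leqslant K\cdot d+K$. *)

theory Defs
  imports "HOL-Analysis.Analysis" "HOL-Algebra.Generated_Groups"
begin

locale topological_group = group G for G (structure) +
  fixes T :: "'a topology"
  assumes topspace_eq_carrier: "topspace T = carrier G"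
    and continuous_mult: "continuous_map (prod_topology T T) T (\<lambda>(x, y). x \<otimes> y)"
    and continuous_inv: "continuous_map T T (\<lambda>x. inv x)"

definition separable_topology :: "'a topology \<Rightarrow> bool" where
  "separable_topology T \<longleftrightarrow>
     (\<exists>C. countable C \<and> C \<subseteq> topspace T \<and> T closure_of C = topspace T)"

(* Metrics are total functions on the type, and Metric_space demands nonnegativity and symmetry
   everywhere. Every metric on the carrier extends (by 0) to such a function, and only values on
   the carrier matter below, so quantifying over these functions loses nothing. *)
definition compatible_left_invariant_metric ::
  "('a, 'b) monoid_scheme \<Rightarrow> 'a topology \<Rightarrow> ('a \<Rightarrow> 'a \<Rightarrow> real) \<Rightarrow> bool" where
  "compatible_left_invariant_metric G T d \<longleftrightarrow>
     Metric_space (carrier G) d \<and>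
     Metric_space.mtopology (carrier G) d = T \<and>
     (\<forall>g\<in>carrier G. \<forall>f\<in>carrier G. \<forall>h\<in>carrier G. d (h \<otimes>\<^bsub>G\<^esub> g) (h \<otimes>\<^bsub>G\<^esub> f) = d g f)"

(* For a set A contained in the carrier, mbounded A says exactly that A has finite diameter
   (see Metric_space.mbounded_alt). *)
definition property_OB :: "('a, 'b) monoid_scheme \<Rightarrow> 'a topology \<Rightarrow> 'a set \<Rightarrow> bool" where
  "property_OB G T A \<longleftrightarrow>
     A \<subseteq> carrier G \<and>
     (\<forall>d. compatible_left_invariant_metric G T d \<longrightarrow> Metric_space.mbounded (carrier G) d A)"

definition maximal_metric ::
  "('a, 'b) monoid_scheme \<Rightarrow> 'a topology \<Rightarrow> ('a \<Rightarrow> 'a \<Rightarrow> real) \<Rightarrow> bool" where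
  "maximal_metric G T d \<longleftrightarrow>
     compatible_left_invariant_metric G T d \<and>
     (\<forall>d'. compatible_left_invariant_metric G T d' \<longrightarrow>
        (\<exists>K. \<forall>g\<in>carrier G. \<forall>f\<in>carrier G. d' g f \<le> K * d g f + K))"

end

theory Submission
  imports Defs
begin

text \<open>
  A left-invariant metric is determined by the length \<open>l g = d \<one> g\<close>, and the metric is compatible
  iff the balls of \<open>l\<close> form a neighbourhood base of \<open>\<one>\<close>.

  Suppose that \<open>G\<close> is generated by an open set with property (OB). Enlarge it to a symmetric open (OB)
  neighbourhood \<open>W\<close> of \<open>\<one>\<close>, take a compatible length \<open>l\<close> (Birkhoff and Kakutani), and replace \<open>l g\<close> by
  the least total \<open>l\<close>-cost of a word over \<open>W\<close> with product \<open>g\<close>. If \<open>W\<close> contains the \<open>l\<close>-ball of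
  radius \<open>e\<close>, short consecutive letters can be merged within \<open>W\<close>, so a word of cost \<open>s\<close> needs only
  about \<open>2 s / e\<close> letters; every other length is bounded on \<open>W\<close>, whence maximality.

  Conversely, balls of a maximal metric have property (OB). Let \<open>H n\<close> be the open subgroup generated
  by the ball of radius \<open>n + 1\<close>. If all \<open>H n\<close> were proper, adding to \<open>d\<close> an ultrametric which is
  constant on each \<open>H (Suc n) - H n\<close> and grows fast enough would contradict maximality.
\<close>

section \<open>Lengths and left-invariant metrics\<close>

context topological_group
begin

text \<open>The analogue of a pseudometric: zeros other than \<one> are allowed.
  \<open>length_separating\<close> excludes them when \<open>T\<close> is T1.\<close>

definition group_length :: "('a \<Rightarrow> real) \<Rightarrow> bool" where
  "group_length l \<longleftrightarrow> l \<one> = 0 \<and> (\<forall>g\<in>carrier G. 0 \<le> l g) \<and>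
     (\<forall>g\<in>carrier G. l (inv g) = l g) \<and>
     (\<forall>g\<in>carrier G. \<forall>h\<in>carrier G. l (g \<otimes> h) \<le> l g + l h)"

text \<open>One half of compatibility: every ball around \<one> is a neighbourhood of \<one>.
  Translation carries this to all other points.\<close>

definition length_continuous :: "('a \<Rightarrow> real) \<Rightarrow> bool" where
  "length_continuous l \<longleftrightarrow> (\<forall>e>0. \<exists>U. openin T U \<and> \<one> \<in> U \<and> (\<forall>g\<in>U. l g < e))"

text \<open>The other half of compatibility: every neighbourhood of \<one> contains a ball.\<close>

definition length_separating :: "('a \<Rightarrow> real) \<Rightarrow> bool" where
  "length_separating l \<longleftrightarrow>
     (\<forall>U. openin T U \<longrightarrow> \<one> \<in> U \<longrightarrow> (\<exists>e>0. \<forall>g\<in>carrier G. l g < e \<longrightarrow> g \<in> U))"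

definition compatible_length :: "('a \<Rightarrow> real) \<Rightarrow> bool" where
  "compatible_length l \<longleftrightarrow> group_length l \<and> length_continuous l \<and> length_separating l"

text \<open>The value 0 off the carrier secures the nonnegativity and symmetry that
  \<open>Metric_space\<close> demands on the whole type.\<close>

definition length_metric :: "('a \<Rightarrow> real) \<Rightarrow> 'a \<Rightarrow> 'a \<Rightarrow> real" where
  "length_metric l g h = (if g \<in> carrier G \<and> h \<in> carrier G then l (inv g \<otimes> h) else 0)"

lemma openin_carrier: "openin T U \<Longrightarrow> U \<subseteq> carrier G"
  using openin_subset topspace_eq_carrier by blast

lemma continuous_map_left_mult:
  assumes "a \<in> carrier G"
  shows "continuous_map T T (\<lambda>x. a \<otimes> x)"
proof -
  have "continuous_map T (prod_topology T T) (\<lambda>x. (a, x))"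
    using assms by (simp add: continuous_map_pairedI topspace_eq_carrier)
  from continuous_map_compose[OF this continuous_mult] show ?thesis
    by (simp add: o_def)
qed

lemma continuous_map_right_mult:
  assumes "a \<in> carrier G"
  shows "continuous_map T T (\<lambda>x. x \<otimes> a)"
proof -
  have "continuous_map T (prod_topology T T) (\<lambda>x. (x, a))"
    using assms by (simp add: continuous_map_pairedI topspace_eq_carrier)
  from continuous_map_compose[OF this continuous_mult] show ?thesis
    by (simp add: o_def)
qed

lemma openin_left_preimage:
  assumes "a \<in> carrier G" "openin T U"
  shows "openin T {x \<in> carrier G. a \<otimes> x \<in> U}"
  using openin_continuous_map_preimage[OF continuous_map_left_mult assms(2)] assms(1)
  by (simp add: topspace_eq_carrier)

lemma openin_right_preimage:
  assumes "a \<in> carrier G" "openin T U"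
  shows "openin T {x \<in> carrier G. x \<otimes> a \<in> U}"
  using openin_continuous_map_preimage[OF continuous_map_right_mult assms(2)] assms(1)
  by (simp add: topspace_eq_carrier)

lemma openin_inv_preimage:
  assumes "openin T U"
  shows "openin T {x \<in> carrier G. inv x \<in> U}"
  using openin_continuous_map_preimage[OF continuous_inv assms] by (simp add: topspace_eq_carrier)

lemma group_lengthD:
  assumes "group_length l"
  shows "l \<one> = 0" "\<And>g. g \<in> carrier G \<Longrightarrow> 0 \<le> l g" "\<And>g. g \<in> carrier G \<Longrightarrow> l (inv g) = l g"
    "\<And>g h. \<lbrakk>g \<in> carrier G; h \<in> carrier G\<rbrakk> \<Longrightarrow> l (g \<otimes> h) \<le> l g + l h"
  using assms by (auto simp: group_length_def)

lemma length_separatingE: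
  assumes "length_separating l" "openin T U" "\<one> \<in> U"
  obtains e where "e > 0" "\<And>g. \<lbrakk>g \<in> carrier G; l g < e\<rbrakk> \<Longrightarrow> g \<in> U"
  using assms unfolding length_separating_def by metis

lemma length_continuousE:
  assumes "length_continuous l" "e > 0"
  obtains U where "openin T U" "\<one> \<in> U" "\<And>g. g \<in> U \<Longrightarrow> l g < e"
  using assms unfolding length_continuous_def by metis

text \<open>Balls around \<open>x\<close> are left translates by \<open>x\<close> of balls around
  \<one>, so the two topologies need comparing only at \<one>. Definiteness comes from T1: a
  neighbourhood of \<one> missing \<open>g\<close> contains a ball, so \<open>l g\<close> is
  positive.\<close>

lemma length_metric_compatible:
  assumes l: "compatible_length l" and t1: "t1_space T"
  shows "compatible_left_invariant_metric G T (length_metric l)"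
proof -
  have gl: "group_length l" and lc: "length_continuous l" and ls: "length_separating l"
    using l by (auto simp: compatible_length_def)
  note L = group_lengthD[OF gl]
  have zero: "g = \<one>" if g: "g \<in> carrier G" "l g = 0" for g
  proof (rule ccontr)
    assume "g \<noteq> \<one>"
    then obtain U where "openin T U" "\<one> \<in> U" "g \<notin> U"
      using t1 g by (metis one_closed t1_space_def topspace_eq_carrier)
    then show False
      using length_separatingE[OF ls, of U] g by metis
  qed
  have sym: "l (inv g \<otimes> h) = l (inv h \<otimes> g)" if "g \<in> carrier G" "h \<in> carrier G" for g h
    using L(3)[of "inv g \<otimes> h"] that by (simp add: inv_mult_group)
  interpret M: Metric_space "carrier G" "length_metric l"
  proof
    fix x y z
    show "0 \<le> length_metric l x y" by (simp add: length_metric_def L)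
    show "length_metric l x y = length_metric l y x" by (simp add: length_metric_def sym)
    assume x: "x \<in> carrier G" and y: "y \<in> carrier G"
    have "inv x \<otimes> y = \<one> \<longleftrightarrow> x = y"
      using x y by (metis inv_closed inv_inv inv_equality l_inv)
    then show "length_metric l x y = 0 \<longleftrightarrow> x = y"
      using x y zero[of "inv x \<otimes> y"] L(1) by (auto simp: length_metric_def)
    assume z: "z \<in> carrier G"
    have "inv x \<otimes> z = (inv x \<otimes> y) \<otimes> (inv y \<otimes> z)"
      using x y z by (metis inv_closed inv_solve_left m_assoc m_closed)
    then show "length_metric l x z \<le> length_metric l x y + length_metric l y z"
      using x y z L(4)[of "inv x \<otimes> y" "inv y \<otimes> z"] by (simp add: length_metric_def)
  qed
  have "openin M.mtopology U \<longleftrightarrow> openin T U" for U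
  proof
    assume U: "openin T U"
    show "openin M.mtopology U"
      unfolding M.openin_mtopology
    proof (intro conjI ballI impI allI openin_carrier U)
      fix x assume "x \<in> U"
      then have x: "x \<in> carrier G" using openin_carrier[OF U] by blast
      obtain e where e: "e > 0" "\<And>g. \<lbrakk>g \<in> carrier G; l g < e\<rbrakk> \<Longrightarrow> g \<in> {y \<in> carrier G. x \<otimes> y \<in> U}"
        using length_separatingE[OF ls openin_left_preimage[OF x U]] \<open>x \<in> U\<close> x by auto
      have "y \<in> U" if "y \<in> M.mball x e" for y
      proof -
        have y: "y \<in> carrier G" "l (inv x \<otimes> y) < e"
          using that x by (auto simp: length_metric_def)
        then have "x \<otimes> (inv x \<otimes> y) \<in> U" using e(2)[of "inv x \<otimes> y"] x by auto
        then show ?thesis using x y by (simp add: m_assoc[symmetric])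
      qed
      then show "\<exists>r>0. M.mball x r \<subseteq> U" using e(1) by blast
    qed
  next
    assume U: "openin M.mtopology U"
    show "openin T U"
    proof (subst openin_subopen, intro ballI)
      fix x assume xU: "x \<in> U"
      then obtain r where r: "r > 0" "M.mball x r \<subseteq> U" and x: "x \<in> carrier G"
        using U unfolding M.openin_mtopology by blast
      obtain N where N: "openin T N" "\<one> \<in> N" "\<And>g. g \<in> N \<Longrightarrow> l g < r"
        using length_continuousE[OF lc r(1)] by metis
      have "openin T {y \<in> carrier G. inv x \<otimes> y \<in> N}"
        using openin_left_preimage N x by simp
      moreover have "{y \<in> carrier G. inv x \<otimes> y \<in> N} \<subseteq> U"
        using N(3) r(2) x by (auto simp: M.mball_def length_metric_def)
      moreover have "x \<in> {y \<in> carrier G. inv x \<otimes> y \<in> N}" using x N by simp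
      ultimately show "\<exists>S. openin T S \<and> x \<in> S \<and> S \<subseteq> U" by blast
    qed
  qed
  then have "M.mtopology = T" by (simp add: topology_eq)
  moreover have "length_metric l (h \<otimes> g) (h \<otimes> f) = length_metric l g f"
    if "g \<in> carrier G" "f \<in> carrier G" "h \<in> carrier G" for g f h
  proof -
    have "inv (h \<otimes> g) \<otimes> (h \<otimes> f) = inv g \<otimes> (inv h \<otimes> (h \<otimes> f))"
      using that by (simp add: inv_mult_group m_assoc)
    also have "\<dots> = inv g \<otimes> f" using that by (simp add: m_assoc[symmetric])
    finally show ?thesis using that by (simp add: length_metric_def)
  qed
  ultimately show ?thesis
    using M.Metric_space_axioms by (simp add: compatible_left_invariant_metric_def)
qed

lemma left_invariant_eq_length:
  assumes "compatible_left_invariant_metric G T d" "g \<in> carrier G" "h \<in> carrier G"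
  shows "d g h = d \<one> (inv g \<otimes> h)"
  using assms unfolding compatible_left_invariant_metric_def
  by (metis inv_closed l_inv)

text \<open>Invariance turns symmetry of \<open>d\<close> into invariance under inversion, and the
  triangle through \<one>, \<open>g\<close>, \<open>g \<otimes> h\<close> into
  subadditivity.\<close>

lemma metric_length_compatible:
  assumes d: "compatible_left_invariant_metric G T d"
  shows "compatible_length (d \<one>)"
proof -
  interpret M: Metric_space "carrier G" d
    using d by (simp add: compatible_left_invariant_metric_def)
  have T: "M.mtopology = T"
    using d by (simp add: compatible_left_invariant_metric_def)
  have "d \<one> (inv g) = d \<one> g" if "g \<in> carrier G" for g
    using left_invariant_eq_length[OF d that one_closed] that M.commute by simp
  moreover have "d \<one> (g \<otimes> h) \<le> d \<one> g + d \<one> h" if "g \<in> carrier G" "h \<in> carrier G" for g h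
    using M.triangle[of \<one> g "g \<otimes> h"] left_invariant_eq_length[OF d, of g "g \<otimes> h"] that
    by (simp add: m_assoc[symmetric])
  ultimately have "group_length (d \<one>)"
    by (auto simp: group_length_def)
  moreover have "length_continuous (d \<one>)"
    unfolding length_continuous_def
  proof (intro allI impI)
    fix e :: real assume "e > 0"
    then show "\<exists>U. openin T U \<and> \<one> \<in> U \<and> (\<forall>g\<in>U. d \<one> g < e)"
      using T M.openin_mball by (intro exI[of _ "M.mball \<one> e"]) auto
  qed
  moreover have "length_separating (d \<one>)"
    unfolding length_separating_def
  proof (intro allI impI)
    fix U assume "openin T U" "\<one> \<in> U"
    then obtain r where "r > 0" "M.mball \<one> r \<subseteq> U"
      unfolding T[symmetric] M.openin_mtopology by blast
    then show "\<exists>e>0. \<forall>g\<in>carrier G. d \<one> g < e \<longrightarrow> g \<in> U"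
      by (intro exI[of _ r]) (auto simp: M.mball_def)
  qed
  ultimately show ?thesis by (simp add: compatible_length_def)
qed

lemma mbounded_iff_length_bounded:
  assumes d: "compatible_left_invariant_metric G T d" and A: "A \<subseteq> carrier G"
  shows "Metric_space.mbounded (carrier G) d A \<longleftrightarrow> (\<exists>K. \<forall>g\<in>A. d \<one> g \<le> K)"
proof -
  interpret M: Metric_space "carrier G" d
    using d by (simp add: compatible_left_invariant_metric_def)
  show ?thesis
  proof
    assume "M.mbounded A"
    \<comment> \<open>The centre supplied by \<open>mbounded\<close> may lie outside the carrier;
      the closed ball is then empty, and so is \<open>A\<close>.\<close>
    then obtain c B where "A \<subseteq> M.mcball c B" "c \<in> carrier G \<or> A = {}"
      unfolding M.mbounded_def by (metis M.mcball_eq_empty subset_empty)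
    then have "d \<one> g \<le> d \<one> c + B" if "g \<in> A" for g
      using that M.triangle[of \<one> c g] by force
    then show "\<exists>K. \<forall>g\<in>A. d \<one> g \<le> K" by blast
  next
    assume "\<exists>K. \<forall>g\<in>A. d \<one> g \<le> K"
    then obtain K where "\<And>g. g \<in> A \<Longrightarrow> d \<one> g \<le> K" by blast
    then have "A \<subseteq> M.mcball \<one> K" using A by (auto simp: M.mcball_def)
    then show "M.mbounded A" by (auto simp: M.mbounded_def)
  qed
qed

section \<open>Words and weighted word lengths\<close>

definition word_prod :: "'a list \<Rightarrow> 'a" where
  "word_prod us = foldr (\<otimes>) us \<one>"

text \<open>For costs as in \<open>word_cost\<close>, this is the largest length that is at most
  \<open>c\<close> on \<open>W\<close>. An infimum is taken because an optimal word need not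
  exist.\<close>

definition word_length :: "'a set \<Rightarrow> ('a \<Rightarrow> real) \<Rightarrow> 'a \<Rightarrow> real" where
  "word_length W c g = Inf {sum_list (map c us) |us. set us \<subseteq> W \<and> word_prod us = g}"

lemma word_prod_simps [simp]:
  "word_prod [] = \<one>" "word_prod (u # us) = u \<otimes> word_prod us"
  by (simp_all add: word_prod_def)

lemma word_prod_closed [simp]: "set us \<subseteq> carrier G \<Longrightarrow> word_prod us \<in> carrier G"
  by (induction us) auto

lemma word_prod_append:
  "\<lbrakk>set us \<subseteq> carrier G; set vs \<subseteq> carrier G\<rbrakk> \<Longrightarrow> word_prod (us @ vs) = word_prod us \<otimes> word_prod vs"
  by (induction us) (auto simp: m_assoc)

lemma word_prod_inv:
  "set us \<subseteq> carrier G \<Longrightarrow> word_prod (rev (map (m_inv G) us)) = inv (word_prod us)"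
proof (induction us)
  case (Cons u us)
  moreover have "set (rev (map (m_inv G) us)) \<subseteq> carrier G" using Cons.prems by auto
  ultimately show ?case by (simp add: word_prod_append inv_mult_group)
qed simp

end

text \<open>Serves two purposes: metrization, where \<open>W\<close> is the whole group and the word
  length repairs a cost without triangle inequality, and maximality, where \<open>W\<close> is an
  (OB) neighbourhood and \<open>c\<close> is already a length.\<close>

locale word_cost = topological_group +
  fixes W :: "'a set" and c :: "'a \<Rightarrow> real"
  assumes W_carrier: "W \<subseteq> carrier G"
    and W_inv: "u \<in> W \<Longrightarrow> inv u \<in> W"
    and W_words: "g \<in> carrier G \<Longrightarrow> \<exists>us. set us \<subseteq> W \<and> word_prod us = g"
    and cost_nonneg: "u \<in> W \<Longrightarrow> 0 \<le> c u"
    and cost_inv: "u \<in> W \<Longrightarrow> c (inv u) = c u"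
begin

lemma word_cost_nonneg: "set us \<subseteq> W \<Longrightarrow> 0 \<le> sum_list (map c us)"
  using cost_nonneg by (intro sum_list_nonneg) auto

lemma word_length_le:
  assumes "set us \<subseteq> W"
  shows "word_length W c (word_prod us) \<le> sum_list (map c us)"
  unfolding word_length_def
  by (rule cInf_lower) (use assms word_cost_nonneg in \<open>auto intro!: bdd_belowI[of _ 0]\<close>)

lemma word_length_ge:
  assumes "g \<in> carrier G" and "\<And>us. \<lbrakk>set us \<subseteq> W; word_prod us = g\<rbrakk> \<Longrightarrow> x \<le> sum_list (map c us)"
  shows "x \<le> word_length W c g"
  unfolding word_length_def
  by (rule cInf_greatest) (use assms W_words in auto)

lemma word_length_lessE:
  assumes "word_length W c g < x" "g \<in> carrier G"
  obtains us where "set us \<subseteq> W" "word_prod us = g" "sum_list (map c us) < x"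
  using assms word_length_ge[of g x] by (meson not_less)

text \<open>Reversing a word and inverting its letters preserves the cost. Concatenating words that
  are within \<open>e/2\<close> of the two infima gives subadditivity up to
  \<open>e\<close>.\<close>

lemma group_length_word_length: "group_length (word_length W c)"
proof -
  have nonneg: "0 \<le> word_length W c g" if "g \<in> carrier G" for g
    by (rule word_length_ge[OF that]) (simp add: word_cost_nonneg)
  have inv_le: "word_length W c (inv g) \<le> word_length W c g" if g: "g \<in> carrier G" for g
  proof (rule word_length_ge[OF g])
    fix us assume us: "set us \<subseteq> W" "word_prod us = g"
    let ?vs = "rev (map (m_inv G) us)"
    have "map c (map (m_inv G) us) = map c us"
      using us cost_inv by auto
    then have "sum_list (map c ?vs) = sum_list (map c us)"
      by (metis rev_map sum_list_rev)
    moreover have "set ?vs \<subseteq> W" using us W_inv by auto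
    moreover have "word_prod ?vs = inv g" using us W_carrier word_prod_inv by blast
    ultimately show "word_length W c (inv g) \<le> sum_list (map c us)"
      using word_length_le by metis
  qed
  have sub: "word_length W c (g \<otimes> h) \<le> word_length W c g + word_length W c h"
    if g: "g \<in> carrier G" and h: "h \<in> carrier G" for g h
  proof (rule field_le_epsilon)
    fix e :: real assume "e > 0"
    obtain us where us: "set us \<subseteq> W" "word_prod us = g"
      "sum_list (map c us) < word_length W c g + e/2"
      by (rule word_length_lessE[of g "word_length W c g + e/2"]) (use g \<open>e > 0\<close> in auto)
    obtain vs where vs: "set vs \<subseteq> W" "word_prod vs = h"
      "sum_list (map c vs) < word_length W c h + e/2"
      by (rule word_length_lessE[of h "word_length W c h + e/2"]) (use h \<open>e > 0\<close> in auto)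
    have "word_prod (us @ vs) = g \<otimes> h"
      using us vs W_carrier by (simp add: word_prod_append subset_trans)
    then have "word_length W c (g \<otimes> h) \<le> sum_list (map c (us @ vs))"
      using word_length_le[of "us @ vs"] us vs by simp
    then show "word_length W c (g \<otimes> h) \<le> word_length W c g + word_length W c h + e"
      using us vs by simp
  qed
  have "word_length W c \<one> = 0"
    using nonneg[of \<one>] word_length_le[of "[]"] by simp
  moreover have "word_length W c (inv g) = word_length W c g" if "g \<in> carrier G" for g
    using inv_le[of g] inv_le[of "inv g"] that by simp
  ultimately show ?thesis using nonneg sub by (auto simp: group_length_def)
qed

lemma word_length_le_cost: "u \<in> W \<Longrightarrow> word_length W c u \<le> c u"
  using word_length_le[of "[u]"] W_carrier by auto

end

text \<open>Cut at the first letter \<open>x\<close> that brings the running cost up to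
  \<open>t\<close>. This letter may carry almost all of the cost, so it is kept apart from both
  sides.\<close>

lemma sum_list_split_point:
  fixes us :: "'b list" and c :: "'b \<Rightarrow> real"
  assumes "us \<noteq> []" "0 \<le> t" "t \<le> sum_list (map c us)"
  shows "\<exists>as x bs. us = as @ x # bs \<and> sum_list (map c as) \<le> t \<and>
           sum_list (map c bs) \<le> sum_list (map c us) - t"
  using assms
proof (induction us arbitrary: t)
  case (Cons u us)
  show ?case
  proof (cases "t \<le> c u \<or> us = []")
    case True
    then show ?thesis using Cons.prems by (intro exI[of _ "[]"] exI[of _ u] exI[of _ us]) auto
  next
    case False
    then have "us \<noteq> []" "0 \<le> t - c u" "t - c u \<le> sum_list (map c us)"
      using Cons.prems by auto
    from Cons.IH[OF this] obtain as x bs where "us = as @ x # bs" "sum_list (map c as) \<le> t - c u"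
      "sum_list (map c bs) \<le> sum_list (map c us) - (t - c u)"
      by blast
    then show ?thesis by (intro exI[of _ "u # as"] exI[of _ x] exI[of _ bs]) auto
  qed
qed simp

subsection \<open>Metrization\<close>

context topological_group
begin

lemma square_neighbourhood:
  assumes "openin T N" "\<one> \<in> N"
  obtains M where "openin T M" "\<one> \<in> M" "\<And>x y. \<lbrakk>x \<in> M; y \<in> M\<rbrakk> \<Longrightarrow> x \<otimes> y \<in> N"
proof -
  define P where "P = {p \<in> topspace (prod_topology T T). (case p of (x, y) \<Rightarrow> x \<otimes> y) \<in> N}"
  have "openin (prod_topology T T) P"
    unfolding P_def by (rule openin_continuous_map_preimage[OF continuous_mult assms(1)])
  moreover have "(\<one>, \<one>) \<in> P" using assms by (simp add: P_def topspace_eq_carrier)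
  ultimately have "\<exists>A B. openin T A \<and> openin T B \<and> \<one> \<in> A \<and> \<one> \<in> B \<and> A \<times> B \<subseteq> P"
    unfolding openin_prod_topology_alt by blast
  then obtain A B where AB: "openin T A" "openin T B" "\<one> \<in> A" "\<one> \<in> B" and sub: "A \<times> B \<subseteq> P"
    by blast
  have "x \<otimes> y \<in> N" if "x \<in> A \<inter> B" "y \<in> A \<inter> B" for x y
    using sub that by (auto simp: P_def)
  then show ?thesis using AB by (intro that[of "A \<inter> B"]) auto
qed

text \<open>Squaring twice suffices: \<open>y \<otimes> z\<close> lies in \<open>A\<close>, and so
  does \<open>x\<close>, since \<one> in \<open>B\<close> forces \<open>B \<subseteq> A\<close>.
  Three factors match the splitting of a word into a prefix, a letter and a suffix.\<close>

lemma symmetric_cube_neighbourhood: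
  assumes N: "openin T N" "\<one> \<in> N"
  obtains M where "openin T M" "\<one> \<in> M" "\<And>x. x \<in> M \<Longrightarrow> inv x \<in> M" "M \<subseteq> N"
    "\<And>x y z. \<lbrakk>x \<in> M; y \<in> M; z \<in> M\<rbrakk> \<Longrightarrow> x \<otimes> (y \<otimes> z) \<in> N"
proof -
  obtain A where A: "openin T A" "\<one> \<in> A" "\<And>x y. \<lbrakk>x \<in> A; y \<in> A\<rbrakk> \<Longrightarrow> x \<otimes> y \<in> N"
    using square_neighbourhood[OF N] by metis
  obtain B where B: "openin T B" "\<one> \<in> B" "\<And>x y. \<lbrakk>x \<in> B; y \<in> B\<rbrakk> \<Longrightarrow> x \<otimes> y \<in> A"
    using square_neighbourhood[OF A(1,2)] by metis
  have Bc: "B \<subseteq> carrier G" by (rule openin_carrier[OF B(1)])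
  then have BA: "B \<subseteq> A" using B(3)[of _ \<one>] B(2) by force
  have AN: "A \<subseteq> N" using A(3)[of _ \<one>] A(2) openin_carrier[OF A(1)] by force
  show ?thesis
  proof (rule that[of "B \<inter> {x \<in> carrier G. inv x \<in> B}"])
    show "openin T (B \<inter> {x \<in> carrier G. inv x \<in> B})"
      using B openin_inv_preimage by blast
  qed (use A B BA AN Bc in \<open>auto simp: subset_iff\<close>)
qed

text \<open>Metrizability supplies the countable base \<open>B n\<close> at \<one>; each new set is
  chosen inside \<open>B n\<close> and with its cube inside the previous set. Starting at the whole
  group gives every element an index.\<close>

lemma neighbourhood_sequence:
  assumes "metrizable_space T"
  obtains U :: "nat \<Rightarrow> 'a set" where "U 0 = carrier G" "\<And>n. openin T (U n)" "\<And>n. \<one> \<in> U n"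
    "\<And>n x. x \<in> U n \<Longrightarrow> inv x \<in> U n" "\<And>n. U (Suc n) \<subseteq> U n"
    "\<And>n x y z. \<lbrakk>x \<in> U (Suc n); y \<in> U (Suc n); z \<in> U (Suc n)\<rbrakk> \<Longrightarrow> x \<otimes> (y \<otimes> z) \<in> U n"
    "\<And>N. \<lbrakk>openin T N; \<one> \<in> N\<rbrakk> \<Longrightarrow> \<exists>n. U n \<subseteq> N"
proof -
  obtain M d where "Metric_space M d" and T: "T = Metric_space.mtopology M d"
    using assms by (auto simp: metrizable_space_def)
  then interpret M: Metric_space M d by simp
  have MG: "M = carrier G" using topspace_eq_carrier T by simp
  define B where "B n = M.mball \<one> (1 / real (Suc n))" for n
  have "openin T (B n)" for n
    unfolding B_def T by (rule M.openin_mball)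
  moreover have "\<one> \<in> M" using MG by simp
  then have "\<one> \<in> B n" for n
    unfolding B_def by (simp only: M.centre_in_mball_iff) simp
  ultimately have B: "openin T (B n)" "\<one> \<in> B n" for n by blast+
  \<comment> \<open>For dependent choice, \<open>P\<close> is the invariant of each single set, with
    its clause for 0 fixing the start, and \<open>Q\<close> relates consecutive sets.\<close>
  define P where "P n A \<longleftrightarrow> openin T A \<and> \<one> \<in> A \<and> (\<forall>x\<in>A. inv x \<in> A) \<and> (n = 0 \<longrightarrow> A = carrier G)"
    for n :: nat and A
  define Q where "Q n A A' \<longleftrightarrow> A' \<subseteq> A \<inter> B n \<and> (\<forall>x\<in>A'. \<forall>y\<in>A'. \<forall>z\<in>A'. x \<otimes> (y \<otimes> z) \<in> A)"
    for n :: nat and A A'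
  have step: "\<exists>A'. P (Suc n) A' \<and> Q n A A'" if "P n A" for n A
  proof -
    have AB: "openin T (A \<inter> B n)" "\<one> \<in> A \<inter> B n" using that B by (auto simp: P_def)
    obtain A' where "openin T A'" "\<one> \<in> A'" "\<And>x. x \<in> A' \<Longrightarrow> inv x \<in> A'" "A' \<subseteq> A \<inter> B n"
      "\<And>x y z. \<lbrakk>x \<in> A'; y \<in> A'; z \<in> A'\<rbrakk> \<Longrightarrow> x \<otimes> (y \<otimes> z) \<in> A \<inter> B n"
      by (rule symmetric_cube_neighbourhood[OF AB]) blast
    then show ?thesis by (intro exI[of _ A']) (auto simp: P_def Q_def)
  qed
  have "P 0 (carrier G)"
    using openin_topspace[of T] by (simp add: P_def topspace_eq_carrier)
  then obtain U where P: "\<And>n. P n (U n)" and Q: "\<And>n. Q n (U n) (U (Suc n))"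
    using dependent_nat_choice[of P Q] step by metis
  have "\<exists>n. U n \<subseteq> N" if N: "openin T N" "\<one> \<in> N" for N
  proof -
    obtain r where r: "r > 0" "M.mball \<one> r \<subseteq> N"
      using N unfolding T M.openin_mtopology by blast
    then obtain n where "1 / real (Suc n) < r" using nat_approx_posE by metis
    then have "B n \<subseteq> M.mball \<one> r"
      unfolding B_def by (intro M.mball_subset_concentric) simp
    with r(2) have "B n \<subseteq> N" by (rule subset_trans[rotated])
    then show ?thesis using Q[of n] by (auto simp: Q_def)
  qed
  then show ?thesis
    using P Q by (intro that[of U]) (auto simp: P_def Q_def)
qed

text \<open>The cost \<open>(1/2) ^ n\<close> for membership in \<open>U n\<close> need not be
  subadditive; passing to the word length repairs this. The fact \<open>key\<close> shows that the
  word length does not become too small to separate.\<close>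

lemma Birkhoff_Kakutani:
  assumes "metrizable_space T"
  obtains l where "compatible_length l"
proof -
  obtain U :: "nat \<Rightarrow> 'a set" where U0: "U 0 = carrier G" and Uo: "\<And>n. openin T (U n)"
    and U1: "\<And>n. \<one> \<in> U n" and Ui: "\<And>n x. x \<in> U n \<Longrightarrow> inv x \<in> U n"
    and Us: "\<And>n. U (Suc n) \<subseteq> U n"
    and U3: "\<And>n x y z. \<lbrakk>x \<in> U (Suc n); y \<in> U (Suc n); z \<in> U (Suc n)\<rbrakk> \<Longrightarrow> x \<otimes> (y \<otimes> z) \<in> U n"
    and UN: "\<And>N. \<lbrakk>openin T N; \<one> \<in> N\<rbrakk> \<Longrightarrow> \<exists>n. U n \<subseteq> N"
    using neighbourhood_sequence[OF assms] by metis
  have Uc: "U n \<subseteq> carrier G" for n by (rule openin_carrier[OF Uo])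
  have anti: "U n \<subseteq> U m" if "m \<le> n" for m n
    using lift_Suc_antimono_le[of U] Us that by blast
  \<comment> \<open>The infimum is 0 exactly when \<open>g\<close> lies in \<open>U n\<close> for
    arbitrarily large \<open>n\<close>, hence in all of them.\<close>
  define c :: "'a \<Rightarrow> real" where "c g = Inf {(1/2) ^ n |n. g \<in> U n}" for g
  have ne: "{(1/2::real) ^ n |n. g \<in> U n} \<noteq> {}" if "g \<in> carrier G" for g
    using that U0 by auto
  have bdd: "bdd_below {(1/2::real) ^ n |n. g \<in> U n}" for g
    by (auto intro!: bdd_belowI[of _ 0])
  have c_nonneg: "0 \<le> c g" if "g \<in> carrier G" for g
    unfolding c_def by (rule cInf_greatest[OF ne[OF that]]) auto
  have c_le: "c g \<le> (1/2) ^ n" if "g \<in> U n" for g n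
    unfolding c_def by (rule cInf_lower[OF _ bdd]) (use that in blast)
  \<comment> \<open>Strictness gains one index: a power of 1/2 below \<open>(1/2) ^ m\<close> has
    exponent at least \<open>Suc m\<close>. Thus the middle letter of a word lands in
    \<open>U (Suc m)\<close> even if it carries the whole cost.\<close>
  have c_less: "g \<in> U (Suc m)" if g: "g \<in> carrier G" "c g < (1/2) ^ m" for g m
  proof -
    obtain n where n: "g \<in> U n" "(1/2::real) ^ n < (1/2) ^ m"
      using g(2) cInf_less_iff[OF ne[OF g(1)] bdd] unfolding c_def by auto
    then have "\<not> n \<le> m" using power_decreasing[of n m "1/2 :: real"] by auto
    then have "Suc m \<le> n" by simp
    then show ?thesis using anti n by blast
  qed
  have inv_U: "inv g \<in> U n \<longleftrightarrow> g \<in> U n" if "g \<in> carrier G" for g n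
    using Ui that by (metis inv_inv)
  interpret C: word_cost G T "carrier G" c
  proof
    fix g assume g: "g \<in> carrier G"
    then show "\<exists>us. set us \<subseteq> carrier G \<and> word_prod us = g"
      by (intro exI[of _ "[g]"]) auto
    show "c (inv g) = c g" using inv_U[OF g] by (simp add: c_def)
  qed (use c_nonneg in auto)
  let ?l = "word_length (carrier G) c"
  \<comment> \<open>Split the word at the letter \<open>x\<close> where the cost passes its middle: both remaining parts cost at
    most half, so the product is a product of three elements of \<open>U (Suc m)\<close>.\<close>
  have key: "word_prod us \<in> U m" if "set us \<subseteq> carrier G" "sum_list (map c us) < (1/2) ^ m" for us m
    using that
  proof (induction us arbitrary: m rule: length_induct)
    case (1 us)
    show ?case
    proof (cases "us = []")
      case True
      then show ?thesis by (simp add: U1)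
    next
      case False
      let ?s = "sum_list (map c us)"
      have s0: "0 \<le> ?s" using C.word_cost_nonneg 1 by blast
      then have "0 \<le> ?s / 2" "?s / 2 \<le> ?s" by simp_all
      from sum_list_split_point[OF False this]
      obtain as x bs where us: "us = as @ x # bs" "sum_list (map c as) \<le> ?s / 2"
        "sum_list (map c bs) \<le> ?s - ?s / 2"
        by blast
      then have bs: "sum_list (map c bs) \<le> ?s / 2" by linarith
      have sets: "set as \<subseteq> carrier G" "set bs \<subseteq> carrier G" "x \<in> carrier G"
        using 1 us by auto
      then have "0 \<le> sum_list (map c as)" "0 \<le> sum_list (map c bs)"
        using C.word_cost_nonneg by blast+
      then have "c x \<le> ?s" using us(1) by simp
      then have "x \<in> U (Suc m)" using c_less[of x m] sets 1 by auto
      moreover have "word_prod vs \<in> U (Suc m)"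
        if "length vs < length us" "set vs \<subseteq> carrier G" "sum_list (map c vs) \<le> ?s / 2" for vs
      proof -
        have "sum_list (map c vs) < (1/2) ^ Suc m" using that(3) 1(3) by simp
        then show ?thesis using 1(1) that(1,2) by blast
      qed
      then have "word_prod as \<in> U (Suc m)" "word_prod bs \<in> U (Suc m)"
        using us(1,2) bs sets by simp_all
      ultimately have "word_prod as \<otimes> (x \<otimes> word_prod bs) \<in> U m" using U3 by blast
      then show ?thesis using us sets by (simp add: word_prod_append)
    qed
  qed
  have "length_continuous ?l"
    unfolding length_continuous_def
  proof (intro allI impI)
    fix e :: real assume "e > 0"
    then obtain n where n: "(1/2) ^ n < e" using real_arch_pow_inv[of e "1/2"] by auto
    have "?l g < e" if "g \<in> U n" for g
      using C.word_length_le_cost[of g] c_le[OF that] n that Uc[of n] by auto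
    then show "\<exists>U. openin T U \<and> \<one> \<in> U \<and> (\<forall>g\<in>U. ?l g < e)"
      using Uo U1 by blast
  qed
  moreover have "length_separating ?l"
    unfolding length_separating_def
  proof (intro allI impI)
    fix N assume "openin T N" "\<one> \<in> N"
    then obtain n where n: "U n \<subseteq> N" using UN by blast
    have "g \<in> N" if "g \<in> carrier G" "?l g < (1/2) ^ n" for g
    proof (rule C.word_length_lessE[OF that(2,1)])
      fix us assume "set us \<subseteq> carrier G" "word_prod us = g" "sum_list (map c us) < (1/2) ^ n"
      then show "g \<in> N" using key[of us n] n by blast
    qed
    then show "\<exists>e>0. \<forall>g\<in>carrier G. ?l g < e \<longrightarrow> g \<in> N"
      by (intro exI[of _ "(1/2) ^ n"]) auto
  qed
  ultimately have "compatible_length ?l"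
    using C.group_length_word_length by (simp add: compatible_length_def)
  then show ?thesis by (rule that)
qed

subsection \<open>Maximality of word metrics\<close>

text \<open>Reading the word from the right, \<open>w\<close> collects letters until its length reaches \<open>e\<close>; it is
  then moved into \<open>h\<close>, so that \<open>h\<close> consumes at most two letters of \<open>W\<close> per cost \<open>e\<close>.\<close>

lemma word_length_comparison:
  assumes l: "group_length l" and l': "group_length l'" and e: "e > 0" and W: "W \<subseteq> carrier G"
    and ball: "\<And>g. \<lbrakk>g \<in> carrier G; l g < e\<rbrakk> \<Longrightarrow> g \<in> W"
    and bound: "\<And>u. u \<in> W \<Longrightarrow> l' u \<le> K"
    and us: "set us \<subseteq> W"
  shows "\<exists>w\<in>carrier G. \<exists>h\<in>carrier G. word_prod us = w \<otimes> h \<and> l w < e \<and>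
           l' h \<le> 2 * K / e * (sum_list (map l us) - l w)"
  using us
proof (induction us)
  case Nil
  then show ?case
    using e by (intro bexI[of _ \<one>]) (auto simp: group_lengthD[OF l] group_lengthD[OF l'])
next
  case (Cons u us)
  note L = group_lengthD[OF l] and L' = group_lengthD[OF l']
  let ?s = "sum_list (map l us)" and ?C = "2 * K / e"
  obtain w h where w: "w \<in> carrier G" "l w < e" and h: "h \<in> carrier G"
    and eq: "word_prod us = w \<otimes> h" and le: "l' h \<le> ?C * (?s - l w)"
    using Cons by auto
  have u: "u \<in> W" "u \<in> carrier G" using Cons.prems W by auto
  have "\<one> \<in> W" using ball[of \<one>] L(1) e by simp
  then have K: "0 \<le> K" using bound[of \<one>] L'(1) by simp
  then have C: "0 \<le> ?C" using e by simp
  show ?case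
  proof (cases "l (u \<otimes> w) < e")
    case True
    \<comment> \<open>The subtracted \<open>l w\<close> is cost not yet spent. Absorbing
      \<open>u\<close> into \<open>w\<close> increases it by at most \<open>l u\<close>, so the
      bound for \<open>h\<close> survives.\<close>
    have "?s - l w \<le> l u + ?s - l (u \<otimes> w)" using L(4)[of u w] u w by simp
    then have "?C * (?s - l w) \<le> ?C * (l u + ?s - l (u \<otimes> w))" by (rule mult_left_mono[OF _ C])
    then show ?thesis
      using True u w h le eq by (intro bexI[of _ "u \<otimes> w"] bexI[of _ h]) (auto simp: m_assoc)
  next
    case False
    \<comment> \<open>Both \<open>u\<close> and \<open>w\<close> lie in \<open>W\<close>, so moving
      them into \<open>h\<close> adds at most \<open>2 * K\<close> to \<open>l'\<close>. The cost
      \<open>l u + l w\<close>, at least \<open>e\<close>, pays for this at rate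
      \<open>2 * K / e\<close>.\<close>
    then have "e \<le> l u + l w" using L(4)[of u w] u w by simp
    then have "?C * e \<le> ?C * (l u + l w)" by (rule mult_left_mono[OF _ C])
    then have "2 * K \<le> ?C * (l u + l w)" using e by simp
    moreover have "l' (u \<otimes> (w \<otimes> h)) \<le> l' u + (l' w + l' h)"
      using L'(4)[of u "w \<otimes> h"] L'(4)[of w h] u w h by simp
    moreover have "l' u \<le> K" "l' w \<le> K" using bound ball u w by auto
    ultimately have "l' (u \<otimes> (w \<otimes> h)) \<le> ?C * (l u + l w) + ?C * (?s - l w)"
      using le by linarith
    also have "\<dots> = ?C * (l u + ?s - l \<one>)" unfolding distrib_left[symmetric] L(1) by simp
    finally show ?thesis
      using u w h eq e L(1) by (intro bexI[of _ \<one>] bexI[of _ "u \<otimes> (w \<otimes> h)"]) auto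
  qed
qed

section \<open>Property (OB) and generating sets\<close>

lemma OB_length_bound:
  assumes "property_OB G T V" "compatible_left_invariant_metric G T d"
  obtains K where "\<And>g. g \<in> V \<Longrightarrow> d \<one> g \<le> K"
proof -
  have "V \<subseteq> carrier G" "Metric_space.mbounded (carrier G) d V"
    using assms by (simp_all add: property_OB_def)
  then show ?thesis using that mbounded_iff_length_bounded[OF assms(2)] by blast
qed

text \<open>Add the inverses and the quotients of elements of \<open>V\<close>: a length bounded by
  \<open>K\<close> on \<open>V\<close> is bounded by \<open>2 * K\<close> on the enlarged
  set.\<close>

lemma symmetric_OB_neighbourhood:
  assumes V: "openin T V" "property_OB G T V" and v: "v \<in> V"
  obtains W where "openin T W" "\<one> \<in> W" "V \<subseteq> W" "\<And>u. u \<in> W \<Longrightarrow> inv u \<in> W" "property_OB G T W"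
proof -
  have Vc: "V \<subseteq> carrier G" by (rule openin_carrier[OF V(1)])
  \<comment> \<open>The last piece consists of the quotients \<open>b \<otimes> inv a\<close> with
    \<open>a\<close>, \<open>b\<close> in \<open>V\<close>, written as a union of open right
    translates. It contains \<one> because \<open>V\<close> has a point.\<close>
  define W where "W = V \<union> {x \<in> carrier G. inv x \<in> V} \<union> (\<Union>a\<in>V. {x \<in> carrier G. x \<otimes> a \<in> V})"
  have one: "\<one> \<in> W" using Vc v by (auto simp: W_def intro!: bexI[of _ v])
  have op: "openin T W" unfolding W_def
    using V(1) Vc openin_inv_preimage openin_right_preimage by (intro openin_Un openin_Union) auto
  have sym: "inv x \<in> W" if "x \<in> W" for x
  proof -
    from that consider "x \<in> V" | "x \<in> carrier G" "inv x \<in> V"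
      | a where "a \<in> V" "x \<in> carrier G" "x \<otimes> a \<in> V" by (auto simp: W_def)
    then show ?thesis
    proof cases
      case 3
      then have "inv x \<otimes> (x \<otimes> a) = a" using Vc by (auto simp: m_assoc[symmetric])
      then have "inv x \<in> {y \<in> carrier G. y \<otimes> (x \<otimes> a) \<in> V}" using 3 by simp
      then show ?thesis using 3 unfolding W_def by blast
    qed (use Vc in \<open>auto simp: W_def\<close>)
  qed
  have "Metric_space.mbounded (carrier G) d W" if d: "compatible_left_invariant_metric G T d" for d
  proof -
    have L: "group_length (d \<one>)" using metric_length_compatible[OF d] by (simp add: compatible_length_def)
    note L = group_lengthD[OF L]
    obtain K where K: "\<And>g. g \<in> V \<Longrightarrow> d \<one> g \<le> K" using OB_length_bound[OF V(2) d] by metis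
    have K0: "0 \<le> K" using K[OF v] L(2)[of v] v Vc by auto
    have "d \<one> x \<le> 2 * K" if "x \<in> W" for x
    proof -
      from that consider "x \<in> V" | "x \<in> carrier G" "inv x \<in> V"
        | a where "a \<in> V" "x \<in> carrier G" "x \<otimes> a \<in> V" by (auto simp: W_def)
      then show ?thesis
      proof cases
        case 1
        then show ?thesis using K[of x] K0 by simp
      next
        case 2
        then show ?thesis using K[of "inv x"] L(3)[of x] K0 by simp
      next
        case 3
        then have a: "a \<in> carrier G" using Vc by blast
        have "x = (x \<otimes> a) \<otimes> inv a" using 3 a by (simp add: m_assoc)
        then have "d \<one> x \<le> d \<one> (x \<otimes> a) + d \<one> a"
          using L(4)[of "x \<otimes> a" "inv a"] L(3)[OF a] 3 a by simp
        then show ?thesis using K[OF 3(1)] K[OF 3(3)] by simp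
      qed
    qed
    then show ?thesis using mbounded_iff_length_bounded[OF d openin_carrier[OF op]] by blast
  qed
  then have "property_OB G T W" using openin_carrier[OF op] by (simp add: property_OB_def)
  moreover have "V \<subseteq> W" by (auto simp: W_def)
  ultimately show ?thesis using that op one sym by blast
qed

text \<open>Symmetry of \<open>W\<close> absorbs the inverses permitted by
  \<open>generate\<close>.\<close>

lemma generate_words:
  assumes "W \<subseteq> carrier G" "V \<subseteq> W" "\<And>u. u \<in> W \<Longrightarrow> inv u \<in> W" "g \<in> generate G V"
  shows "\<exists>us. set us \<subseteq> W \<and> word_prod us = g"
  using assms(4)
proof (induction rule: generate.induct)
  case one
  then show ?case by (intro exI[of _ "[]"]) simp
next
  case (incl h)
  then show ?case using assms by (intro exI[of _ "[h]"]) auto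
next
  case (inv h)
  then show ?case using assms by (intro exI[of _ "[inv h]"]) auto
next
  case (eng g h)
  then obtain us vs where "set us \<subseteq> W" "word_prod us = g" "set vs \<subseteq> W" "word_prod vs = h"
    by blast
  then show ?case
    using assms(1) by (intro exI[of _ "us @ vs"]) (auto simp: word_prod_append subset_trans)
qed

text \<open>The word length dominates \<open>l\<close>, so it still separates; on the open set
  \<open>W\<close> it is at most \<open>l\<close>, by one-letter words, so it is still continuous.
  Maximality follows from \<open>word_length_comparison\<close> applied to the length of each
  competing metric.\<close>

lemma OB_neighbourhood_imp_maximal:
  assumes t1: "t1_space T" and l: "compatible_length l"
    and W: "openin T W" "\<one> \<in> W" "\<And>u. u \<in> W \<Longrightarrow> inv u \<in> W" "property_OB G T W"
    and words: "\<And>g. g \<in> carrier G \<Longrightarrow> \<exists>us. set us \<subseteq> W \<and> word_prod us = g"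
  shows "maximal_metric G T (length_metric (word_length W l))"
proof -
  have gl: "group_length l" and lc: "length_continuous l" and ls: "length_separating l"
    using l by (auto simp: compatible_length_def)
  note L = group_lengthD[OF gl]
  have Wc: "W \<subseteq> carrier G" by (rule openin_carrier[OF W(1)])
  interpret C: word_cost G T W l
  proof
    show "W \<subseteq> carrier G" by (rule Wc)
    show "\<exists>us. set us \<subseteq> W \<and> word_prod us = g" if "g \<in> carrier G" for g
      using words[OF that] .
    show "inv u \<in> W" "0 \<le> l u" "l (inv u) = l u" if "u \<in> W" for u
      using that W(3) Wc L(2,3) by blast+
  qed
  let ?l = "word_length W l"
  have gl': "group_length ?l" by (rule C.group_length_word_length)
  have prod_le: "l (word_prod us) \<le> sum_list (map l us)" if "set us \<subseteq> W" for us
    using that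
  proof (induction us)
    case (Cons u us)
    then show ?case using L(4)[of u "word_prod us"] Wc by fastforce
  qed (simp add: L)
  have ge: "l g \<le> ?l g" if "g \<in> carrier G" for g
    by (rule C.word_length_ge[OF that]) (use prod_le in metis)
  have "length_separating ?l"
    unfolding length_separating_def
  proof (intro allI impI)
    fix U assume "openin T U" "\<one> \<in> U"
    then obtain e where "e > 0" "\<And>g. \<lbrakk>g \<in> carrier G; l g < e\<rbrakk> \<Longrightarrow> g \<in> U"
      using length_separatingE[OF ls] by metis
    then show "\<exists>e>0. \<forall>g\<in>carrier G. ?l g < e \<longrightarrow> g \<in> U" using ge by (meson le_less_trans)
  qed
  moreover have "length_continuous ?l"
    unfolding length_continuous_def
  proof (intro allI impI)
    fix e :: real assume "e > 0"
    then obtain U where U: "openin T U" "\<one> \<in> U" "\<And>g. g \<in> U \<Longrightarrow> l g < e"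
      using length_continuousE[OF lc] by metis
    then show "\<exists>U. openin T U \<and> \<one> \<in> U \<and> (\<forall>g\<in>U. ?l g < e)"
      using W(1,2) C.word_length_le_cost by (intro exI[of _ "U \<inter> W"]) force
  qed
  ultimately have comp: "compatible_left_invariant_metric G T (length_metric ?l)"
    using length_metric_compatible gl' t1 by (simp add: compatible_length_def)
  obtain e where e: "e > 0" "\<And>g. \<lbrakk>g \<in> carrier G; l g < e\<rbrakk> \<Longrightarrow> g \<in> W"
    using length_separatingE[OF ls W(1,2)] by metis
  have "\<exists>K. \<forall>g\<in>carrier G. \<forall>f\<in>carrier G. d g f \<le> K * length_metric ?l g f + K"
    if d: "compatible_left_invariant_metric G T d" for d
  proof -
    have gd: "group_length (d \<one>)"
      using metric_length_compatible[OF d] by (simp add: compatible_length_def)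
    note D = group_lengthD[OF gd]
    obtain K where K: "\<And>g. g \<in> W \<Longrightarrow> d \<one> g \<le> K" using OB_length_bound[OF W(4) d] by metis
    have K0: "0 \<le> K" using K[OF W(2)] D(1) by simp
    define C where "C = 2 * K / e"
    have C0: "0 \<le> C" using K0 e by (simp add: C_def)
    have words_bound: "d \<one> (word_prod us) \<le> C * sum_list (map l us) + K" if us: "set us \<subseteq> W" for us
    proof -
      obtain w h where w: "w \<in> carrier G" "h \<in> carrier G" "word_prod us = w \<otimes> h" "l w < e"
        "d \<one> h \<le> C * (sum_list (map l us) - l w)"
        using word_length_comparison[OF gl gd e(1) Wc e(2) K us] unfolding C_def by blast
      have "C * (sum_list (map l us) - l w) \<le> C * sum_list (map l us)"
        using L(2)[OF w(1)] C0 by (intro mult_left_mono) auto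
      then show ?thesis using D(4)[OF w(1,2)] K[OF e(2)[OF w(1,4)]] w by simp
    qed
    \<comment> \<open>A word within 1 of the infimum yields \<open>C * (?l g + 1) + K\<close>. The
      constant \<open>C + K\<close> can then act as both factor and summand.\<close>
    have bound: "d \<one> g \<le> (C + K) * ?l g + (C + K)" if g: "g \<in> carrier G" for g
    proof -
      obtain us where us: "set us \<subseteq> W" "word_prod us = g" "sum_list (map l us) < ?l g + 1"
        by (rule C.word_length_lessE[of g "?l g + 1"]) (use g in auto)
      have "d \<one> g \<le> C * sum_list (map l us) + K" using words_bound us by blast
      also have "\<dots> \<le> C * (?l g + 1) + K" using us(3) C0 by (simp add: mult_left_mono)
      also have "\<dots> \<le> (C + K) * ?l g + (C + K)"
        using group_lengthD(2)[OF gl' g] K0 by (simp add: algebra_simps)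
      finally show ?thesis .
    qed
    have "d g f \<le> (C + K) * length_metric ?l g f + (C + K)"
      if "g \<in> carrier G" "f \<in> carrier G" for g f
      unfolding left_invariant_eq_length[OF d that]
      using bound[of "inv g \<otimes> f"] that by (simp add: length_metric_def)
    then show ?thesis by blast
  qed
  then show ?thesis using comp by (simp add: maximal_metric_def)
qed

lemma generating_OB_imp_maximal:
  assumes "metrizable_space T" "openin T V" "property_OB G T V" "generate G V = carrier G"
  shows "\<exists>d. maximal_metric G T d"
proof -
  \<comment> \<open>The construction of \<open>W\<close> needs a point of the generating set. An
    empty set generates only the trivial group, where the carrier can replace it.\<close>
  obtain V' where V': "openin T V'" "property_OB G T V'" "generate G V' = carrier G" "V' \<noteq> {}"
  proof (cases "V = {}")
    case True
    then have G: "carrier G = {\<one>}" using assms(4) generate_empty by simp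
    have "property_OB G T (carrier G)"
      unfolding property_OB_def using mbounded_iff_length_bounded G by auto
    moreover have "generate G (carrier G) = carrier G"
      using generate_incl[OF subset_refl] by (auto intro: generate.incl)
    moreover have "openin T (carrier G)"
      using openin_topspace[of T] by (simp add: topspace_eq_carrier)
    ultimately show ?thesis using that G by blast
  qed (use assms in blast)
  then obtain W where W: "openin T W" "\<one> \<in> W" "V' \<subseteq> W" "\<And>u. u \<in> W \<Longrightarrow> inv u \<in> W"
    "property_OB G T W"
    using symmetric_OB_neighbourhood by (metis ex_in_conv)
  obtain l where "compatible_length l" using Birkhoff_Kakutani[OF assms(1)] .
  moreover have "\<exists>us. set us \<subseteq> W \<and> word_prod us = g" if "g \<in> carrier G" for g
    using generate_words[OF openin_carrier[OF W(1)] W(3,4)] V'(3) that by blast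
  ultimately show ?thesis
    using OB_neighbourhood_imp_maximal W metrizable_imp_t1_space[OF assms(1)] by blast
qed

subsection \<open>Chains of open subgroups\<close>

text \<open>A chain of open subgroups carries, for every nondecreasing weight, a continuous ultrametric
  length; its weights may be chosen to outgrow \<open>l\<close> along elements outside the subgroups.\<close>

lemma unbounded_ratio_length:
  fixes H :: "nat \<Rightarrow> 'a set"
  assumes sub: "\<And>n. subgroup (H n) G" and mono: "mono H" and cover: "carrier G \<subseteq> (\<Union>n. H n)"
    and op: "openin T (H 0)" and proper: "\<And>n. H n \<noteq> carrier G"
    and l: "\<And>g. g \<in> carrier G \<Longrightarrow> 0 \<le> l g"
  obtains l' where "group_length l'" "length_continuous l'"
    "\<And>K. \<exists>g\<in>carrier G. l' g > K * l g + K"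
proof -
  have "\<exists>x. \<forall>n. x n \<in> carrier G - H n"
    using proper subgroup.subset[OF sub] by (intro choice) blast
  then obtain x where x: "\<And>n. x n \<in> carrier G" "\<And>n. x n \<notin> H n" by blast
  \<comment> \<open>The jump of \<open>f\<close> from \<open>n\<close> to \<open>Suc n\<close> gives
    \<open>x n\<close>, which lies outside \<open>H n\<close>, length at least
    \<open>n * (l (x n) + 1)\<close>. This beats \<open>K * l (x n) + K\<close> as soon as
    \<open>n > K\<close>.\<close>
  define f where "f m = (\<Sum>n<m. real n * (l (x n) + 1))" for m
  have f_mono: "f m \<le> f m'" if "m \<le> m'" for m m'
    unfolding f_def using that l x by (intro sum_mono2) auto
  have f_nonneg: "0 \<le> f m" for m
    unfolding f_def using l x by (intro sum_nonneg) auto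
  define r where "r g = (LEAST n. g \<in> H n)" for g
  have r_in: "g \<in> H (r g)" if "g \<in> carrier G" for g
    unfolding r_def using cover that by (metis (mono_tags) LeastI UN_E subsetD)
  have r_le: "r g \<le> n" if "g \<in> H n" for g n
    unfolding r_def using that by (rule Least_le)
  have inv_H: "inv g \<in> H n \<longleftrightarrow> g \<in> H n" if "g \<in> carrier G" for g n
    using subgroup.m_inv_closed[OF sub] that by (metis inv_inv)
  let ?l = "\<lambda>g. f (r g)"
  have r0: "r g = 0" if "g \<in> H 0" for g using r_le[OF that] by simp
  have f0: "f 0 = 0" by (simp add: f_def)
  have one: "\<one> \<in> H 0" by (rule subgroup.one_closed[OF sub])
  \<comment> \<open>Closure of \<open>H ?m\<close> under products gives the ultrametric bound
    \<open>f ?m\<close>. It equals one of the two summands, and the other is nonnegative.\<close>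
  have "?l (g \<otimes> h) \<le> ?l g + ?l h" if g: "g \<in> carrier G" and h: "h \<in> carrier G" for g h
  proof -
    let ?m = "max (r g) (r h)"
    have "g \<in> H ?m" "h \<in> H ?m"
      using r_in g h monoD[OF mono, of _ ?m] by (meson max.cobounded1 max.cobounded2 subsetD)+
    then have "r (g \<otimes> h) \<le> ?m" using subgroup.m_closed[OF sub] r_le by blast
    then have "?l (g \<otimes> h) \<le> f ?m" by (rule f_mono)
    also have "f ?m \<le> ?l g + ?l h" using f_nonneg by (auto simp: max_def)
    finally show ?thesis .
  qed
  moreover have "?l (inv g) = ?l g" if "g \<in> carrier G" for g
    using inv_H[OF that] by (simp add: r_def)
  ultimately have gl: "group_length ?l"
    using f_nonneg r0[OF one] f0 by (auto simp: group_length_def)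
  \<comment> \<open>The length vanishes on the open subgroup \<open>H 0\<close>, because
    \<open>f 0\<close> is an empty sum.\<close>
  have lc: "length_continuous ?l"
    unfolding length_continuous_def using op one r0 f0 by (metis)
  have "\<exists>g\<in>carrier G. ?l g > K * l g + K" for K
  proof -
    obtain n where n: "K < real n" using reals_Archimedean2 by blast
    \<comment> \<open>Strict inequality is what makes \<open>f (r (x n))\<close> include the summand
      with index \<open>n\<close>.\<close>
    have "n < r (x n)"
    proof (rule ccontr)
      assume "\<not> n < r (x n)"
      then show False using r_in[OF x(1)[of n]] monoD[OF mono, of "r (x n)" n] x(2)[of n] by auto
    qed
    then have "f (Suc n) \<le> ?l (x n)" by (intro f_mono) simp
    moreover have "f (Suc n) = f n + real n * (l (x n) + 1)" by (simp add: f_def)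
    moreover have "K * (l (x n) + 1) < real n * (l (x n) + 1)"
      using n l[OF x(1)[of n]] by (intro mult_strict_right_mono) auto
    ultimately have "K * l (x n) + K < ?l (x n)"
      using f_nonneg[of n] by (simp add: algebra_simps)
    then show ?thesis using x(1) by blast
  qed
  then show ?thesis using that gl lc by blast
qed

lemma group_length_add:
  assumes "group_length l" "group_length l'"
  shows "group_length (\<lambda>g. l g + l' g)"
proof -
  have "l (g \<otimes> h) + l' (g \<otimes> h) \<le> l g + l' g + (l h + l' h)"
    if "g \<in> carrier G" "h \<in> carrier G" for g h
    using group_lengthD(4)[OF assms(1) that] group_lengthD(4)[OF assms(2) that] by simp
  then show ?thesis
    using group_lengthD(1-3)[OF assms(1)] group_lengthD(1-3)[OF assms(2)]
    by (simp add: group_length_def)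
qed

text \<open>Adding a nonnegative term preserves separation, so \<open>l'\<close> may vanish on a
  whole open subgroup.\<close>

lemma compatible_length_add:
  assumes l: "compatible_length l" and gl': "group_length l'" and lc': "length_continuous l'"
  shows "compatible_length (\<lambda>g. l g + l' g)"
proof -
  have gl: "group_length l" and lc: "length_continuous l" and ls: "length_separating l"
    using l by (auto simp: compatible_length_def)
  have "length_continuous (\<lambda>g. l g + l' g)"
    unfolding length_continuous_def
  proof (intro allI impI)
    fix e :: real assume "e > 0"
    then have e: "e / 2 > 0" by simp
    obtain U where U: "openin T U" "\<one> \<in> U" "\<And>g. g \<in> U \<Longrightarrow> l g < e / 2"
      using length_continuousE[OF lc e] by metis
    obtain U' where U': "openin T U'" "\<one> \<in> U'" "\<And>g. g \<in> U' \<Longrightarrow> l' g < e / 2"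
      using length_continuousE[OF lc' e] by metis
    have "l g + l' g < e" if "g \<in> U \<inter> U'" for g
      using U(3)[of g] U'(3)[of g] that by simp
    then show "\<exists>U. openin T U \<and> \<one> \<in> U \<and> (\<forall>g\<in>U. l g + l' g < e)"
      using U U' by (intro exI[of _ "U \<inter> U'"]) auto
  qed
  moreover have "length_separating (\<lambda>g. l g + l' g)"
    unfolding length_separating_def
  proof (intro allI impI)
    fix U assume "openin T U" "\<one> \<in> U"
    then obtain e where e: "e > 0" "\<And>g. \<lbrakk>g \<in> carrier G; l g < e\<rbrakk> \<Longrightarrow> g \<in> U"
      using length_separatingE[OF ls] by metis
    have "g \<in> U" if "g \<in> carrier G" "l g + l' g < e" for g
      using e(2)[OF that(1)] group_lengthD(2)[OF gl' that(1)] that by simp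
    then show "\<exists>e>0. \<forall>g\<in>carrier G. l g + l' g < e \<longrightarrow> g \<in> U" using e(1) by blast
  qed
  ultimately show ?thesis using group_length_add[OF gl gl'] by (simp add: compatible_length_def)
qed

section \<open>Balls of a maximal metric and the subgroups they generate\<close>

lemma openin_generate:
  assumes N: "openin T N" "\<one> \<in> N"
  shows "openin T (generate G N)"
proof (subst openin_subopen, intro ballI)
  have Nc: "N \<subseteq> carrier G" by (rule openin_carrier[OF N(1)])
  note sg = generate_is_subgroup[OF Nc]
  fix x assume x: "x \<in> generate G N"
  then have xc: "x \<in> carrier G" using subgroup.subset[OF sg] by blast
  \<comment> \<open>The left translate of \<open>N\<close> by \<open>x\<close> is an open
    neighbourhood of \<open>x\<close> inside the subgroup.\<close>
  have "y \<in> generate G N" if "y \<in> carrier G" "inv x \<otimes> y \<in> N" for y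
  proof -
    have "x \<otimes> (inv x \<otimes> y) \<in> generate G N"
      using x that generate.incl generate.eng by metis
    then show ?thesis using that xc by (simp add: m_assoc[symmetric])
  qed
  moreover have "openin T {y \<in> carrier G. inv x \<otimes> y \<in> N}"
    using openin_left_preimage xc N by simp
  moreover have "x \<in> {y \<in> carrier G. inv x \<otimes> y \<in> N}" using xc N by simp
  ultimately show "\<exists>S. openin T S \<and> x \<in> S \<and> S \<subseteq> generate G N" by blast
qed

lemma maximal_imp_generating_OB:
  assumes t1: "t1_space T" and max: "maximal_metric G T d"
  shows "\<exists>V. openin T V \<and> property_OB G T V \<and> generate G V = carrier G"
proof -
  have d: "compatible_left_invariant_metric G T d"
    using max by (simp add: maximal_metric_def)
  interpret M: Metric_space "carrier G" d
    using d by (simp add: compatible_left_invariant_metric_def)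
  have T: "M.mtopology = T"
    using d by (simp add: compatible_left_invariant_metric_def)
  \<comment> \<open>Radius \<open>Suc n\<close> makes already \<open>B 0\<close> a neighbourhood of
    \<one>, so that its generated subgroup is open.\<close>
  define B where "B n = M.mball \<one> (real (Suc n))" for n
  have B: "openin T (B n)" "\<one> \<in> B n" "B n \<subseteq> carrier G" for n
    using T M.openin_mball by (auto simp: B_def)
  have "property_OB G T (B n)" for n
    unfolding property_OB_def
  proof (intro conjI B(3) allI impI)
    fix d' assume d': "compatible_left_invariant_metric G T d'"
    then obtain K where K: "\<And>g f. \<lbrakk>g \<in> carrier G; f \<in> carrier G\<rbrakk> \<Longrightarrow> d' g f \<le> K * d g f + K"
      using max unfolding maximal_metric_def by metis
    \<comment> \<open>The absolute value is taken because \<open>maximal_metric\<close> does not fix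
      the sign of \<open>K\<close>.\<close>
    have "d' \<one> g \<le> \<bar>K\<bar> * real (Suc n) + K" if "g \<in> B n" for g
    proof -
      have g: "g \<in> carrier G" "d \<one> g < real (Suc n)" using that by (auto simp: B_def)
      have "K * d \<one> g \<le> \<bar>K\<bar> * real (Suc n)"
        using g M.nonneg[of \<one> g] by (intro mult_mono) auto
      then show ?thesis using K[OF one_closed g(1)] by simp
    qed
    then show "Metric_space.mbounded (carrier G) d' (B n)"
      using mbounded_iff_length_bounded[OF d' B(3)] by blast
  qed
  moreover have "\<exists>n. generate G (B n) = carrier G"
  proof (rule ccontr)
    assume "\<not> (\<exists>n. generate G (B n) = carrier G)"
    then have proper: "generate G (B n) \<noteq> carrier G" for n by blast
    have sub: "subgroup (generate G (B n)) G" for n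
      by (rule generate_is_subgroup[OF B(3)])
    have mono: "mono (\<lambda>n. generate G (B n))"
      unfolding B_def by (intro monoI mono_generate M.mball_subset_concentric) simp
    have cover: "carrier G \<subseteq> (\<Union>n. generate G (B n))"
    proof
      fix g assume g: "g \<in> carrier G"
      obtain n where "d \<one> g < real n" using reals_Archimedean2 by blast
      then have "g \<in> B n" using g by (auto simp: B_def)
      then show "g \<in> (\<Union>n. generate G (B n))" using generate.incl[of g "B n" G] by blast
    qed
    have op: "openin T (generate G (B 0))" using openin_generate B by blast
    obtain l' where l': "group_length l'" "length_continuous l'"
      "\<And>K. \<exists>g\<in>carrier G. l' g > K * d \<one> g + K"
      by (rule unbounded_ratio_length[where l = "d \<one>" and H = "\<lambda>n. generate G (B n)",
            OF sub mono cover op proper M.nonneg]) blast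
    \<comment> \<open>Since \<open>l'\<close> need not separate, it is added to the length of
      \<open>d\<close> to obtain a compatible metric. Maximality bounds the sum, hence
      \<open>l'\<close> itself, contradicting its growth.\<close>
    let ?l = "\<lambda>g. d \<one> g + l' g"
    have "compatible_left_invariant_metric G T (length_metric ?l)"
      using length_metric_compatible[OF compatible_length_add t1]
        metric_length_compatible[OF d] l'(1,2) by blast
    then obtain K where "\<And>g f. \<lbrakk>g \<in> carrier G; f \<in> carrier G\<rbrakk> \<Longrightarrow> length_metric ?l g f \<le> K * d g f + K"
      using max unfolding maximal_metric_def by metis
    then have K: "?l g \<le> K * d \<one> g + K" if "g \<in> carrier G" for g
      using that one_closed by (fastforce simp: length_metric_def)
    obtain g where "g \<in> carrier G" "l' g > K * d \<one> g + K" using l'(3) by blast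
    then show False using K[of g] M.nonneg[of \<one> g] by simp
  qed
  ultimately show ?thesis using B(1) by blast
qed

end

theorem theorem3:
  fixes G :: "('a, 'b) monoid_scheme" and T :: "'a topology"
  assumes "topological_group G T"
    and "separable_topology T"
    and "metrizable_space T"
  shows "(\<exists>d. maximal_metric G T d) \<longleftrightarrow>
         (\<exists>V. openin T V \<and> property_OB G T V \<and> generate G V = carrier G)"
proof -
  interpret topological_group G T by (rule assms(1))
  show ?thesis
    using maximal_imp_generating_OB metrizable_imp_t1_space[OF assms(3)]
      generating_OB_imp_maximal[OF assms(3)] by blast
qed

end
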